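(* As formal Laurent series in $x$ with coefficients in $\mathbb{Z}[y]$, $$S_{[0]}(x,y)=2x\,W_{[1]}(x,y).$$
   Context: An $n$-string is a binary string of length $n$. A run of a bit $b$ is a maximal block of consecutive $b$'s of length at least $1$; it is odd (even) if its length is odd (even). $w_{[1]}(n,m)$ is, for $n\ge 0$, the number of $n$-strings containing exactly $m$ odd runs of ones (any number of other runs is allowed). By convention $w_{[1]}(-1,m)=1$ if $m=0$ and $0$ otherwise, and $w_{[1]}(n,m)=0$ for $n<-1$ or $m<0$. Set $W_{[1]}(x,y)=\sum_{n,m}w_{[1]}(n,m)x^ny^m$, over all integers $n,m$. $s_{[0]}(n,m)$ is, for $n\ge 1$, the number of $n$-strings in which the total number of even (nonnull) runs of ones and even (nonnull) runs of zeros is exactly $m$. By convention $s_{[0]}(0,m)=2$ if $m=0$ and $0$ otherwise, and $s_{[0]}(n,m)=0$ for $n<0$ or $m<0$. Set $S_{[0]}(x,y)=\sum_{n,m}s_{[0]}(n,m)x^ny^m$. *)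

theory Defs
  imports
    "HOL-Computational_Algebra.Formal_Laurent_Series"
    "HOL-Computational_Algebra.Polynomial"
begin

definition n_strings :: "int \<Rightarrow> bool list set" where
  "n_strings n = {u. int (length u) = n}"

text \<open>
  Bit 1 is \<open>True\<close>, bit 0 is \<open>False\<close>. Positions are counted from 0. A run is represented by the pair \<open>(i, j)\<close> of its first
  position \<open>i\<close> and the position \<open>j\<close> following its last one, so its length is \<open>j - i\<close>.
  The last two conditions express maximality.
\<close>

definition runs :: "bool \<Rightarrow> bool list \<Rightarrow> (nat \<times> nat) set" where
  "runs b u = {(i, j). i < j \<and> j \<le> length u \<and> (\<forall>k. i \<le> k \<and> k < j \<longrightarrow> u ! k = b) \<and>
     (i > 0 \<longrightarrow> u ! (i - 1) \<noteq> b) \<and> (j < length u \<longrightarrow> u ! j \<noteq> b)}"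

definition odd_runs :: "bool \<Rightarrow> bool list \<Rightarrow> (nat \<times> nat) set" where
  "odd_runs b u = {(i, j) \<in> runs b u. odd (j - i)}"

definition even_runs :: "bool \<Rightarrow> bool list \<Rightarrow> (nat \<times> nat) set" where
  "even_runs b u = {(i, j) \<in> runs b u. even (j - i)}"

definition w1 :: "int \<Rightarrow> int \<Rightarrow> int" where
  "w1 n m =
    (if n \<ge> 0 then int (card {u \<in> n_strings n. int (card (odd_runs True u)) = m})
     else if n = -1 \<and> m = 0 then 1 else 0)"

definition s0 :: "int \<Rightarrow> int \<Rightarrow> int" where
  "s0 n m =
    (if n \<ge> 1 then
       int (card {u \<in> n_strings n.
              int (card (even_runs True u)) + int (card (even_runs False u)) = m})
     else if n = 0 \<and> m = 0 then 2 else 0)"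

text \<open>
  The formal series \<open>\<Sum>n m. a n m x\<^sup>n y\<^sup>m\<close> over all integers \<open>n\<close> and \<open>m\<close>; the variable \<open>x\<close> is
  \<open>fls_X\<close> and \<open>y\<close> is the indeterminate of \<open>int poly\<close>. This is meaningful only if \<open>a n m\<close> vanishes
  for \<open>m < 0\<close>, for all but finitely many \<open>m\<close> at each \<open>n\<close>, and for all sufficiently small \<open>n\<close>;
  the lemmas below show that \<open>w1\<close> and \<open>s0\<close> satisfy these conditions and that the resulting
  series have the intended coefficients.
\<close>

definition gen_series :: "(int \<Rightarrow> int \<Rightarrow> int) \<Rightarrow> int poly fls" where
  "gen_series a = Abs_fls (\<lambda>n. \<Sum>m\<in>{m. a n m \<noteq> 0}. monom (a n m) (nat m))"

definition W1 :: "int poly fls" where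
  "W1 = gen_series w1"

definition S0 :: "int poly fls" where
  "S0 = gen_series s0"

lemma coeff_gen_series:
  assumes neg: "\<And>n m. m < 0 \<Longrightarrow> a n m = 0"
    and fin: "\<And>n. finite {m. a n m \<noteq> 0}"
    and low: "\<And>n m. n < N \<Longrightarrow> a n m = 0"
  shows "poly.coeff (fls_nth (gen_series a) n) k = a n (int k)"
proof -
  have "fls_nth (gen_series a) n = (\<Sum>m\<in>{m. a n m \<noteq> 0}. monom (a n m) (nat m))"
    unfolding gen_series_def
    by (rule nth_Abs_fls_lower_bound[where N = N]) (simp add: low)
  moreover have "poly.coeff (\<Sum>m\<in>{m. a n m \<noteq> 0}. monom (a n m) (nat m)) k
      = (\<Sum>m\<in>{m. a n m \<noteq> 0}. if m = int k then a n m else 0)"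
    unfolding coeff_sum
  proof (rule sum.cong[OF refl])
    fix m assume "m \<in> {m. a n m \<noteq> 0}"
    then have "m \<ge> 0" using neg[of m n] by force
    then show "poly.coeff (monom (a n m) (nat m)) k = (if m = int k then a n m else 0)"
      by auto
  qed
  ultimately show ?thesis
    by (simp add: sum.delta[OF fin])
qed

lemma finite_n_strings: "finite (n_strings n)"
proof -
  have "n_strings n \<subseteq> {u. set u \<subseteq> UNIV \<and> length u = nat n}"
    by (auto simp: n_strings_def)
  then show ?thesis
    by (rule finite_subset) (rule finite_lists_length_eq, simp)
qed

lemma finite_card_support:
  "finite {m. card {u \<in> n_strings n. f u = m} \<noteq> 0}"
proof (rule finite_subset)
  show "{m. card {u \<in> n_strings n. f u = m} \<noteq> 0} \<subseteq> f ` n_strings n"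
    by (auto simp: card_eq_0_iff)
qed (simp add: finite_n_strings)

lemma coeff_W1: "poly.coeff (fls_nth W1 n) k = w1 n (int k)"
  unfolding W1_def
proof (rule coeff_gen_series[where N = "-1"])
  fix n
  show "finite {m. w1 n m \<noteq> 0}"
    by (rule finite_subset[OF _ finite.insertI[OF
          finite_card_support[of n "\<lambda>u. int (card (odd_runs True u))"], of 0]])
      (auto simp: w1_def split: if_splits)
qed (auto simp: w1_def)

lemma coeff_S0: "poly.coeff (fls_nth S0 n) k = s0 n (int k)"
  unfolding S0_def
proof (rule coeff_gen_series[where N = 0])
  fix n
  show "finite {m. s0 n m \<noteq> 0}"
    by (rule finite_subset[OF _ finite.insertI[OF finite_card_support[of n
          "\<lambda>u. int (card (even_runs True u)) + int (card (even_runs False u))"], of 0]])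
      (auto simp: s0_def split: if_splits)
qed (auto simp: s0_def)

end

theory Submission imports Defs begin

text \<open>
  Record, for each pair of neighbouring bits of a nonempty string \<open>u\<close>, whether the two bits agree.
  This gives a string \<open>v\<close> that is shorter by one. A run of length \<open>l\<close> in \<open>u\<close>, whichever its bit,
  contains \<open>l - 1\<close> agreeing neighbour pairs and is delimited by disagreeing ones, so it becomes
  a run of ones of length \<open>l - 1\<close> in \<open>v\<close>, or disappears if \<open>l = 1\<close>. Since \<open>l = 1\<close> is odd, nothing
  is lost on the even runs: the even runs of \<open>u\<close> of both bits correspond to the odd runs of ones
  of \<open>v\<close> (\<open>card_even_runs\<close>). Every \<open>v\<close> comes from exactly two strings \<open>u\<close>, one for each choice of
  the first bit (\<open>card_strings_by_agreements\<close>). This gives \<open>s0 n m = 2 * w1 (n - 1) m\<close> for positive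
  \<open>n\<close>, and the conventional values at \<open>n = 0\<close> are such that the relation holds there as well; the
  factor \<open>x\<close> in the series identity is the index shift by one.
\<close>

definition agreements :: "bool list \<Rightarrow> bool list" where
  "agreements u = map2 (=) u (tl u)"

lemma length_agreements: "length (agreements u) = length u - 1"
  by (simp add: agreements_def)

lemma nth_agreements:
  "k < length u - 1 \<Longrightarrow> agreements u ! k \<longleftrightarrow> u ! k = u ! Suc k"
  by (simp add: agreements_def nth_tl)

text \<open>
  The inverse construction, given the first bit: the next bit equals the current one \<open>b\<close> exactly
  if the agreement bit \<open>c\<close> is set, so it is the truth value of \<open>b = c\<close>.
\<close>

fun from_agreements :: "bool \<Rightarrow> bool list \<Rightarrow> bool list" where
  "from_agreements b [] = [b]"
| "from_agreements b (c # v) = b # from_agreements (b = c) v"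

lemma length_from_agreements: "length (from_agreements b v) = Suc (length v)"
  by (induction v arbitrary: b) auto

lemma hd_from_agreements: "hd (from_agreements b v) = b"
  by (cases v) auto

lemma agreements_Cons:
  "u \<noteq> [] \<Longrightarrow> agreements (x # u) = (x = hd u) # agreements u"
  by (cases u) (auto simp: agreements_def)

lemma agreements_from_agreements: "agreements (from_agreements b v) = v"
proof (induction v arbitrary: b)
  case Nil
  show ?case by (simp add: agreements_def)
next
  case (Cons c v)
  have "from_agreements (b = c) v \<noteq> []"
    using length_from_agreements[of "b = c" v] by auto
  then show ?case
    using Cons by (cases b) (simp_all add: agreements_Cons hd_from_agreements)
qed

lemma from_agreements_agreements:
  "u \<noteq> [] \<Longrightarrow> from_agreements (hd u) (agreements u) = u"
proof (induction u)
  case (Cons x u)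
  show ?case
  proof (cases "u = []")
    case True
    then show ?thesis by (simp add: agreements_def)
  next
    case False
    have "(x = (x = hd u)) = hd u" by auto
    with False Cons.IH show ?thesis by (simp add: agreements_Cons)
  qed
qed simp

lemma card_strings_by_agreements:
  "card {u. length u = Suc N \<and> P (agreements u)} = 2 * card {v. length v = N \<and> P v}"
proof -
  let ?U = "{u. length u = Suc N \<and> P (agreements u)}" and ?V = "{v. length v = N \<and> P v}"
  have inv: "from_agreements (hd u) (agreements u) = u" if "u \<in> ?U" for u
  proof (rule from_agreements_agreements)
    show "u \<noteq> []" using that by auto
  qed
  have left: "(hd u, agreements u) \<in> UNIV \<times> ?V" if "u \<in> ?U" for u
    using that by (simp add: length_agreements)
  have right: "from_agreements b v \<in> ?U" if "v \<in> ?V" for b v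
    using that by (simp add: length_from_agreements agreements_from_agreements)
  have "bij_betw (\<lambda>u. (hd u, agreements u)) ?U (UNIV \<times> ?V)"
  proof (rule bij_betw_byWitness[where f' = "\<lambda>p. from_agreements (fst p) (snd p)"])
    show "(\<lambda>u. (hd u, agreements u)) ` ?U \<subseteq> UNIV \<times> ?V"
      by (rule image_subsetI) (rule left)
    show "(\<lambda>p. from_agreements (fst p) (snd p)) ` (UNIV \<times> ?V) \<subseteq> ?U"
      by (rule image_subsetI, rule right) (simp add: mem_Times_iff)
  qed (simp_all add: inv hd_from_agreements agreements_from_agreements)
  then have "card ?U = card ((UNIV :: bool set) \<times> ?V)"
    by (rule bij_betw_same_card)
  then show ?thesis
    by (simp add: card_cartesian_product)
qed

lemma finite_runs: "finite (runs b u)"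
  by (rule finite_subset[of _ "{..length u} \<times> {..length u}"]) (auto simp: runs_def)

text \<open>
  Agreement at the positions \<open>i, \<dots>, j - 1\<close> means that \<open>u\<close> is constant on \<open>i, \<dots>, j\<close>, one position
  more; this is why the end of the run moves by one while its start stays.
\<close>

lemma runs_agreements_iff:
  assumes "u \<noteq> []"
  shows "(i, j) \<in> runs True (agreements u) \<longleftrightarrow> i < j \<and> (i, Suc j) \<in> runs (u ! i) u"
proof
  assume r: "(i, j) \<in> runs True (agreements u)"
  then have ij: "i < j" and "j \<le> length u - 1"
    by (simp_all add: runs_def length_agreements)
  then have j: "j < length u"
    by linarith
  have eq: "u ! k = u ! Suc k" if "i \<le> k" "k < j" for k
    using r j that nth_agreements[of k u] by (auto simp: runs_def)
  have const: "u ! k = u ! i" if "i \<le> k" "k \<le> j" for k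
    using that by (induction k rule: dec_induct) (auto simp: eq[symmetric])
  have left: "u ! (i - 1) \<noteq> u ! i" if "0 < i"
    using r ij j that nth_agreements[of "i - 1" u] by (auto simp: runs_def)
  have right: "u ! Suc j \<noteq> u ! i" if "Suc j < length u"
    using r ij that nth_agreements[of j u] const[of j]
    by (auto simp: runs_def length_agreements)
  show "i < j \<and> (i, Suc j) \<in> runs (u ! i) u"
    unfolding runs_def mem_Collect_eq case_prod_conv
  proof (intro conjI allI impI)
    show "i < j" "i < Suc j" "Suc j \<le> length u" using ij j by simp_all
    show "u ! k = u ! i" if "i \<le> k \<and> k < Suc j" for k
      using const[of k] that by linarith
  qed (use left right in blast)+
next
  assume r: "i < j \<and> (i, Suc j) \<in> runs (u ! i) u"
  then have ij: "i < j" and j: "Suc j \<le> length u"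
    and left: "0 < i \<Longrightarrow> u ! (i - 1) \<noteq> u ! i"
    and right: "Suc j < length u \<Longrightarrow> u ! Suc j \<noteq> u ! i"
    unfolding runs_def mem_Collect_eq case_prod_conv by blast+
  have const: "u ! k = u ! i" if "i \<le> k" "k \<le> j" for k
    using r le_imp_less_Suc[OF that(2)] that(1)
    unfolding runs_def mem_Collect_eq case_prod_conv by blast
  have "agreements u ! k" if "i \<le> k" "k < j" for k
    using that j const[of k] const[of "Suc k"] nth_agreements[of k u] by auto
  moreover have "\<not> agreements u ! (i - 1)" if "0 < i"
    using that ij j left nth_agreements[of "i - 1" u] by auto
  moreover have "\<not> agreements u ! j" if "j < length u - 1"
    using that ij right const[of j] nth_agreements[of j u] by auto
  ultimately show "(i, j) \<in> runs True (agreements u)"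
    using ij j by (auto simp: runs_def length_agreements)
qed

text \<open>
  The bit of a run is the bit at its first position, so runs of ones and runs of zeros can be
  pooled without overlap. An even run has length at least 2, hence it does not disappear.
\<close>

lemma card_even_runs:
  assumes "u \<noteq> []"
  shows "card (even_runs True u) + card (even_runs False u) = card (odd_runs True (agreements u))"
proof -
  have bit: "u ! i = b" if "(i, j) \<in> runs b u" for i j b
    using that by (auto simp: runs_def)
  have fin: "finite (even_runs b u)" for b
    by (rule finite_subset[OF _ finite_runs[of b u]]) (auto simp: even_runs_def)
  have "even_runs True u \<inter> even_runs False u = {}"
    using bit[where b = True] bit[where b = False] unfolding even_runs_def by blast
  then have "card (even_runs True u) + card (even_runs False u)
      = card (even_runs True u \<union> even_runs False u)"
    by (simp add: card_Un_disjoint fin)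
  also have "even_runs True u \<union> even_runs False u
      = (\<lambda>(i, j). (i, Suc j)) ` odd_runs True (agreements u)" (is "?E = ?f ` ?O")
  proof (intro equalityI subsetI)
    fix p assume "p \<in> ?E"
    then obtain i j b where p: "p = (i, j)" and r: "(i, j) \<in> runs b u" and ev: "even (j - i)"
      by (cases p) (auto simp: even_runs_def)
    have "i < j" using r by (simp add: runs_def)
    with ev obtain l where l: "j = Suc l" "i < l"
      by (cases j) (auto simp: less_Suc_eq)
    have "(i, l) \<in> ?O"
      using r ev l bit[OF r] by (simp add: odd_runs_def runs_agreements_iff[OF assms] Suc_diff_le)
    then show "p \<in> ?f ` ?O"
      using p l by force
  next
    fix p assume "p \<in> ?f ` ?O"
    then obtain i l where p: "p = (i, Suc l)" and r: "(i, l) \<in> runs True (agreements u)"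
      and od: "odd (l - i)"
      by (auto simp: odd_runs_def)
    have "i < l" "(i, Suc l) \<in> runs (u ! i) u"
      using r by (simp_all add: runs_agreements_iff[OF assms])
    then show "p \<in> ?E"
      using p od by (cases "u ! i") (auto simp: even_runs_def Suc_diff_le)
  qed
  also have "card \<dots> = card ?O"
    by (rule card_image) (auto simp: inj_on_def)
  finally show ?thesis .
qed

lemma s0_eq_w1: "s0 n m = 2 * w1 (n - 1) m"
proof (cases "n \<ge> 1")
  case True
  define N where "N = nat (n - 1)"
  have n: "n = int (Suc N)"
    using True by (simp add: N_def)
  have U: "{u \<in> n_strings n. int (card (even_runs True u)) + int (card (even_runs False u)) = m}
      = {u. length u = Suc N \<and> int (card (odd_runs True (agreements u))) = m}"
  proof (intro Collect_cong)
    fix u :: "bool list"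
    have "int (card (even_runs True u)) + int (card (even_runs False u))
        = int (card (odd_runs True (agreements u)))" if "length u = Suc N"
      using card_even_runs[of u] that by force
    then show "(u \<in> n_strings n \<and>
          int (card (even_runs True u)) + int (card (even_runs False u)) = m) \<longleftrightarrow>
        (length u = Suc N \<and> int (card (odd_runs True (agreements u))) = m)"
      unfolding n_strings_def n by auto
  qed
  have V: "{v \<in> n_strings (n - 1). int (card (odd_runs True v)) = m}
      = {v. length v = N \<and> int (card (odd_runs True v)) = m}"
    by (auto simp: n_strings_def n)
  have "s0 n m = int (card {u. length u = Suc N \<and> int (card (odd_runs True (agreements u))) = m})"
    using True by (simp add: s0_def U)
  also have "\<dots> = 2 * int (card {v. length v = N \<and> int (card (odd_runs True v)) = m})"
    by (simp add: card_strings_by_agreements[where P = "\<lambda>v. int (card (odd_runs True v)) = m"])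
  also have "\<dots> = 2 * w1 (n - 1) m"
    using True by (simp add: w1_def V)
  finally show ?thesis .
next
  case False
  then show ?thesis by (auto simp: s0_def w1_def)
qed

theorem theorem5p2: "S0 = 2 * fls_X * W1"
proof (rule fls_eqI, rule poly_eqI)
  fix n k
  have "2 * fls_X * W1 = fls_X * W1 + fls_X * W1"
    by (simp only: mult_2 distrib_right)
  then have "fls_nth (2 * fls_X * W1) n = fls_nth W1 (n - 1) + fls_nth W1 (n - 1)"
    by (simp only: fls_plus_nth fls_X_times_conv_shift fls_shift_nth add_uminus_conv_diff)
  then show "poly.coeff (fls_nth S0 n) k = poly.coeff (fls_nth (2 * fls_X * W1) n) k"
    by (simp only: coeff_add coeff_S0 coeff_W1 s0_eq_w1 mult_2)
qed

end
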